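(* Let $\Gamma=\delta^2 I$ with $\delta>0$, let the prior of $a\in\mathbb{R}^J$ be the Gaussian measure $\mu_a=N(0,I)$ on $\mathbb{R}^J$, and for $b\in\mathbb{C}^{NM}$ let $\mu(a|b)$ be the posterior distribution, i.e. the probability measure on $\mathbb{R}^J$ with density $$\frac{d\mu(a|b)}{d\mu_a}(a)=\frac{1}{Z(b)}\exp(-\Psi(a;b)),\qquad Z(b)=\int_{\mathbb{R}^J}\exp(-\Psi(a;b))\,d\mu_a(a),\qquad \Psi(a;b)=\frac{|\mathcal{L}(a)-b|^2}{2\delta^2},$$ where $\mathcal{L}:\mathbb{R}^J\to\mathbb{C}^{NM}$ is the forward map $\mathcal{L}=\mathcal{H}\circ\mathcal{G}\circ\mathcal{T}$ defined in the context. Then the posterior distribution is locally Lipschitz with respect to $b$ in the Hellinger distance: for every $r>0$ there exists a constant $C=C(r)>0$ such that for all $b,b'\in\mathbb{C}^{NM}$ with $\max\{|b|_\Gamma,|b'|_\Gamma\}<r$, $$d_{\rm H}(\mu(a|b),\mu(a|b'))\le C\,|b-b'|_\Gamma .$$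
   Context: Setting. $\Omega\subset\mathbb{R}^2$ is a region bounded by a closed curve $\partial\Omega$, and $D\subset\mathbb{R}^2$ is a bounded open set compactly contained in $\Omega$. Fixed are points $x_1,\dots,x_N\in\partial\Omega$, wave numbers $k_1,\dots,k_M\in[k_{\min},k_{\max}]$ with $k_{\min}>0$, an integer $n\geq 1$, constants $w_1,\dots,w_n>0$, constants $-\infty=c_0<c_1<\cdots<c_n=\infty$, an integer $J\ge1$, centers $\theta_1,\dots,\theta_J\in\mathbb{R}^2$ and widths $\lambda_1,\dots,\lambda_J>0$. RBF expansion map: $\mathcal{T}:\mathbb{R}^J\to C(\bar D)$, $\mathcal{T}(a)=\varphi(\cdot,a)$ with $\varphi(x,a)=\sum_{s=1}^J a_s\exp\left(-\frac{|x-\theta_s|^2}{2\lambda_s^2}\right)$. Level set map: $\mathcal{G}:C(\bar D)\to L^2(D)$, $\mathcal{G}(\varphi)=\sum_{l=1}^n w_l\mathbb{I}_{D_l}$, where $D_l=\{x\in D: c_{l-1}\le\varphi(x)<c_l\}$ and $\mathbb{I}_{D_l}$ is the indicator function of $D_l$. Acoustic operator: $\mathcal{H}:L^2(D)\to\mathbb{C}^{NM}$ stacks the vectors $\mathcal{H}_{k_m}f=\left[\int_D f(y)H_0^{(1)}(k_m|x_j-y|)\,dy\right]_{j=1}^N\in\mathbb{C}^N$ for $m=1,\dots,M$, where $H_0^{(1)}$ is the Hankel function of the first kind of order $0$. $|\cdot|$ is the Euclidean norm and $|b|_\Gamma:=|\Gamma^{-1/2}b|$ (so $|b|_\Gamma=|b|/\delta$).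 Hellinger distance: for measures $\mu,\mu'$ absolutely continuous with respect to $\mu_a$, $$d_{\rm H}(\mu,\mu')=\left(\frac12\int_{\mathbb{R}^J}\left(\sqrt{\frac{d\mu}{d\mu_a}}-\sqrt{\frac{d\mu'}{d\mu_a}}\right)^2d\mu_a\right)^{1/2}.$$ *)

theory Defs
  imports "HOL-Probability.Probability"
begin

text \<open>
  The Hankel function of the first kind of order 0 on the positive real axis, which is
  the only place where it is evaluated. The series for \<open>Y\<^sub>0\<close> is the standard one,
  normalised by Euler's constant and with the harmonic numbers as coefficients.
\<close>

definition bessel_J0 :: "real \<Rightarrow> real" where
  "bessel_J0 z = (\<Sum>k. (- 1) ^ k * (z\<^sup>2 / 4) ^ k / (fact k)\<^sup>2)"

definition bessel_Y0 :: "real \<Rightarrow> real" where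
  "bessel_Y0 z = 2 / pi * ((ln (z / 2) + euler_mascheroni) * bessel_J0 z
      - (\<Sum>k. (- 1) ^ k * harm k * (z\<^sup>2 / 4) ^ k / (fact k)\<^sup>2))"

definition hankel1_0 :: "real \<Rightarrow> complex" where
  "hankel1_0 z = complex_of_real (bessel_J0 z) + \<i> * complex_of_real (bessel_Y0 z)"

definition region_bounded_by_closed_curve :: "(real ^ 2) set \<Rightarrow> bool" where
  "region_bounded_by_closed_curve \<Omega> \<longleftrightarrow>
     open \<Omega> \<and> connected \<Omega> \<and> bounded \<Omega> \<and>
     (\<exists>\<gamma>. path \<gamma> \<and> pathfinish \<gamma> = pathstart \<gamma> \<and> path_image \<gamma> = frontier \<Omega>)"

definition compactly_contained :: "'a :: topological_space set \<Rightarrow> 'a set \<Rightarrow> bool" where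
  "compactly_contained D \<Omega> \<longleftrightarrow> compact (closure D) \<and> closure D \<subseteq> \<Omega>"

text \<open>
  Elements of \<open>C(closure D)\<close> and of \<open>L\<^sup>2(D)\<close> are represented by functions on the whole
  plane, of which only the values on \<open>D\<close> enter.
\<close>

definition rbf_expansion ::
    "('j \<Rightarrow> real ^ 2) \<Rightarrow> ('j \<Rightarrow> real) \<Rightarrow> real ^ 'j :: finite \<Rightarrow> real ^ 2 \<Rightarrow> real" where
  "rbf_expansion \<theta> lam a = (\<lambda>x. \<Sum>s\<in>UNIV. a $ s * exp (- (norm (x - \<theta> s))\<^sup>2 / (2 * (lam s)\<^sup>2)))"

definition level_region ::
    "(real ^ 2) set \<Rightarrow> (nat \<Rightarrow> ereal) \<Rightarrow> (real ^ 2 \<Rightarrow> real) \<Rightarrow> nat \<Rightarrow> (real ^ 2) set" where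
  "level_region D c \<phi> l = {x \<in> D. c (l - 1) \<le> ereal (\<phi> x) \<and> ereal (\<phi> x) < c l}"

definition level_set_map ::
    "(real ^ 2) set \<Rightarrow> nat \<Rightarrow> (nat \<Rightarrow> real) \<Rightarrow> (nat \<Rightarrow> ereal) \<Rightarrow> (real ^ 2 \<Rightarrow> real) \<Rightarrow> real ^ 2 \<Rightarrow> real"
  where
  "level_set_map D n w c \<phi> = (\<lambda>x. \<Sum>l = 1..n. w l * indicator (level_region D c \<phi> l) x)"

definition acoustic_single ::
    "(real ^ 2) set \<Rightarrow> ('n \<Rightarrow> real ^ 2) \<Rightarrow> real \<Rightarrow> (real ^ 2 \<Rightarrow> real) \<Rightarrow> complex ^ 'n :: finite" where
  "acoustic_single D x \<kappa> f =
     (\<chi> j. LINT y:D|lborel. complex_of_real (f y) * hankel1_0 (\<kappa> * norm (x j - y)))"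

text \<open>\<open>\<complex>\<^bsup>NM\<^esup>\<close> is the space of vectors indexed by pairs (wave number, point).\<close>

definition acoustic_operator ::
    "(real ^ 2) set \<Rightarrow> ('n \<Rightarrow> real ^ 2) \<Rightarrow> ('m \<Rightarrow> real) \<Rightarrow> (real ^ 2 \<Rightarrow> real)
       \<Rightarrow> complex ^ ('m :: finite \<times> 'n :: finite)" where
  "acoustic_operator D x k f = (\<chi> p. acoustic_single D x (k (fst p)) f $ snd p)"

definition forward_map ::
    "(real ^ 2) set \<Rightarrow> ('n \<Rightarrow> real ^ 2) \<Rightarrow> ('m \<Rightarrow> real) \<Rightarrow> nat \<Rightarrow> (nat \<Rightarrow> real) \<Rightarrow> (nat \<Rightarrow> ereal)
       \<Rightarrow> ('j \<Rightarrow> real ^ 2) \<Rightarrow> ('j \<Rightarrow> real) \<Rightarrow> real ^ 'j :: finite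
       \<Rightarrow> complex ^ ('m :: finite \<times> 'n :: finite)" where
  "forward_map D x k n w c \<theta> lam =
     acoustic_operator D x k \<circ> level_set_map D n w c \<circ> rbf_expansion \<theta> lam"

text \<open>The norm weighted by \<open>\<Gamma> = \<delta>\<^sup>2 I\<close>, for which the inverse square root is multiplication by \<open>1/\<delta>\<close>.\<close>

definition weighted_norm :: "real \<Rightarrow> 'a :: real_normed_vector \<Rightarrow> real" where
  "weighted_norm \<delta> b = norm ((1 / \<delta>) *\<^sub>R b)"

definition gaussian_prior :: "(real ^ 'j :: finite) measure" where
  "gaussian_prior = density lborel (\<lambda>a. ennreal (\<Prod>s\<in>UNIV. std_normal_density (a $ s)))"

definition potential ::
    "('p \<Rightarrow> 'b :: real_normed_vector) \<Rightarrow> real \<Rightarrow> 'p \<Rightarrow> 'b \<Rightarrow> real" where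
  "potential L \<delta> a b = (norm (L a - b))\<^sup>2 / (2 * \<delta>\<^sup>2)"

definition evidence ::
    "(real ^ 'j :: finite \<Rightarrow> 'b :: real_normed_vector) \<Rightarrow> real \<Rightarrow> 'b \<Rightarrow> real" where
  "evidence L \<delta> b = (LINT a|gaussian_prior. exp (- potential L \<delta> a b))"

definition posterior ::
    "(real ^ 'j :: finite \<Rightarrow> 'b :: real_normed_vector) \<Rightarrow> real \<Rightarrow> 'b \<Rightarrow> (real ^ 'j) measure" where
  "posterior L \<delta> b =
     density gaussian_prior (\<lambda>a. ennreal (1 / evidence L \<delta> b * exp (- potential L \<delta> a b)))"

text \<open>
  Meaningful for finite measures \<open>\<mu>\<close> and \<open>\<mu>'\<close> that are absolutely continuous with respect to
  the sigma-finite reference measure \<open>\<nu>\<close>; the integrand is then integrable.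
\<close>

definition hellinger_dist :: "'a measure \<Rightarrow> 'a measure \<Rightarrow> 'a measure \<Rightarrow> real" where
  "hellinger_dist \<nu> \<mu> \<mu>' =
     sqrt (1 / 2 * (LINT a|\<nu>. (sqrt (enn2real (RN_deriv \<nu> \<mu> a)) - sqrt (enn2real (RN_deriv \<nu> \<mu>' a)))\<^sup>2))"

end

theory Submission
  imports Defs
begin

text \<open>
  Two properties of the forward map \<open>L\<close> carry the proof: it is bounded, say by \<open>R\<close>, and it is
  Borel measurable.

  Boundedness holds because the level set map takes values between \<open>0\<close> and the sum of the weights
  and because the Hankel kernel is bounded: the observation points lie on the frontier of the open
  set \<open>\<Omega>\<close> and hence at positive distance from the compact set \<open>closure D\<close>, so that the arguments
  of the Hankel function stay in a compact interval away from its logarithmic singularity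
  (\<open>hankel_kernel_bounded\<close>). Measurability follows from Tonelli's theorem, since the integrand is
  jointly measurable in the coefficient vector and the point of the plane
  (\<open>measurable_forward_map\<close>).

  For a bounded measurable map, the square root of the posterior density is
  \<open>exp (- (\<Psi> + ln Z) / 2)\<close>. With \<open>\<rho> = R / \<delta> + r\<close>, data in the ball of radius \<open>r\<close> have weighted
  misfits at most \<open>\<rho>\<close>. As \<open>\<Psi>\<close> is half the squared weighted misfit, it lies between \<open>0\<close> and
  \<open>\<rho>\<^sup>2 / 2\<close> and is \<open>\<rho>\<close>-Lipschitz in the data, uniformly in the coefficients. Integrating over the
  prior, a probability measure, transfers both to the evidence: \<open>ln Z\<close> is at least \<open>- \<rho>\<^sup>2 / 2\<close>
  and \<open>\<rho>\<close>-Lipschitz. The exponent \<open>- (\<Psi> + ln Z) / 2\<close> is therefore at most \<open>\<rho>\<^sup>2 / 4\<close> and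
  \<open>\<rho>\<close>-Lipschitz, so the roots of the densities differ pointwise by at most
  \<open>\<rho> exp (\<rho>\<^sup>2 / 4)\<close> times the distance of the data, and this is a Lipschitz constant of the
  posterior (\<open>hellinger_dist_posterior_le\<close>).
\<close>

section \<open>The Gaussian prior\<close>

lemma prod_Basis_vec:
  fixes f :: "real \<Rightarrow> 'a :: comm_monoid_mult" and a :: "real ^ 'j :: finite"
  shows "(\<Prod>b\<in>Basis. f (a \<bullet> b)) = (\<Prod>s\<in>UNIV. f (a $ s))"
proof -
  have B: "(Basis :: (real ^ 'j) set) = (\<lambda>s. axis s 1) ` UNIV"
    by (auto simp: Basis_vec_def)
  have "inj (\<lambda>s. axis s (1 :: real) :: real ^ 'j)"
    by (auto intro!: injI simp: axis_eq_axis)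
  then show ?thesis
    unfolding B by (subst prod.reindex) (simp_all add: inner_axis)
qed

lemma borel_measurable_vec_nth_real [measurable]:
  "(\<lambda>a :: real ^ 'j :: finite. a $ s) \<in> borel_measurable borel"
  by (intro borel_measurable_continuous_onI continuous_intros)

lemma prob_space_gaussian_prior: "prob_space (gaussian_prior :: (real ^ 'j :: finite) measure)"
proof
  have one: "(\<integral>\<^sup>+x. ennreal (std_normal_density x) \<partial>lborel) = 1"
    using prob_space.emeasure_space_1[OF prob_space_normal_density[of 1 0]]
    by (simp add: emeasure_density)
  have "(\<integral>\<^sup>+a. ennreal (\<Prod>s\<in>UNIV. std_normal_density (a $ s)) \<partial>(lborel :: (real ^ 'j) measure))
      = (\<integral>\<^sup>+a. (\<Prod>b\<in>Basis. ennreal (std_normal_density (a \<bullet> b))) \<partial>(lborel :: (real ^ 'j) measure))"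
    by (simp add: prod_Basis_vec[of "\<lambda>t. ennreal (std_normal_density t)"] prod_ennreal)
  also have "\<dots> = 1"
    by (subst nn_integral_lborel_prod) (simp_all add: one)
  finally show "emeasure gaussian_prior (space (gaussian_prior :: (real ^ 'j) measure)) = 1"
    by (simp add: gaussian_prior_def emeasure_density)
qed

lemma sets_gaussian_prior [measurable_cong, simp]: "sets gaussian_prior = sets borel"
  by (simp add: gaussian_prior_def)

lemma space_gaussian_prior [simp]: "space gaussian_prior = UNIV"
  by (simp add: gaussian_prior_def)

section \<open>Lipschitz dependence of the posterior on the data\<close>

lemma abs_exp_diff_le:
  fixes s t u :: real
  assumes "s \<le> u" "t \<le> u"
  shows "\<bar>exp s - exp t\<bar> \<le> exp u * \<bar>s - t\<bar>"
proof -
  have *: "exp q - exp p \<le> exp u * (q - p)" if "p \<le> q" "q \<le> u" for p q :: real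
  proof -
    have "exp q - exp p = exp q * (1 - exp (p - q))"
      by (simp add: algebra_simps flip: exp_add)
    also have "\<dots> \<le> exp q * (q - p)"
      using exp_ge_add_one_self[of "p - q"] by (intro mult_left_mono) (simp_all add: algebra_simps)
    also have "\<dots> \<le> exp u * (q - p)"
      using that by (intro mult_right_mono) auto
    finally show ?thesis .
  qed
  show ?thesis
  proof (cases "s \<le> t")
    case True
    then have "exp s \<le> exp t" by simp
    with *[of s t] True assms show ?thesis by (simp add: abs_if)
  next
    case False
    then have "exp t \<le> exp s" by simp
    with *[of t s] False assms show ?thesis by (simp add: abs_if)
  qed
qed

lemma weighted_norm_eq: "\<delta> > 0 \<Longrightarrow> weighted_norm \<delta> v = norm v / \<delta>"
  by (simp add: weighted_norm_def)

lemma potential_eq_weighted_norm: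
  "\<delta> > 0 \<Longrightarrow> potential L \<delta> a b = (weighted_norm \<delta> (L a - b))\<^sup>2 / 2"
  by (simp add: potential_def weighted_norm_eq power_divide)

context
  fixes L :: "real ^ 'j :: finite \<Rightarrow> 'b :: euclidean_space" and R r \<delta> \<rho> :: real
  assumes L [measurable]: "L \<in> borel_measurable borel"
    and bounded_L: "\<And>a. norm (L a) \<le> R"
    and \<delta>: "\<delta> > 0"
  defines "\<rho> \<equiv> R / \<delta> + r"
begin

interpretation prior: prob_space "gaussian_prior :: (real ^ 'j) measure"
  by (rule prob_space_gaussian_prior)

text \<open>
  The constant \<open>\<rho>\<close> of this section bounds the weighted misfit for all coefficient vectors and all
  data in the ball of radius \<open>r\<close>; every estimate on the posterior is expressed through it.
\<close>

lemma weighted_misfit_le: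
  assumes "weighted_norm \<delta> b < r"
  shows "weighted_norm \<delta> (L a - b) \<le> \<rho>"
proof -
  have "norm (L a - b) \<le> R + norm b"
    using norm_triangle_ineq4[of "L a" b] bounded_L[of a] by linarith
  then have "weighted_norm \<delta> (L a - b) \<le> (R + norm b) / \<delta>"
    using \<delta> by (simp add: weighted_norm_eq divide_right_mono)
  then show ?thesis
    using assms \<delta> by (simp add: weighted_norm_eq \<rho>_def add_divide_distrib)
qed

lemma potential_le:
  assumes "weighted_norm \<delta> b < r"
  shows "potential L \<delta> a b \<le> \<rho>\<^sup>2 / 2"
  using weighted_misfit_le[OF assms, of a] \<delta>
  by (simp add: potential_eq_weighted_norm power_mono weighted_norm_def)

lemma potential_nonneg: "0 \<le> potential L \<delta> a b"
  by (simp add: potential_def)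

text \<open>
  The potential is half a square, and squaring is \<open>2\<rho>\<close>-Lipschitz on \<open>[0, \<rho>]\<close>, where the misfits
  lie; the misfit itself is \<open>1\<close>-Lipschitz in the data for the weighted norm.
\<close>

lemma potential_lipschitz:
  assumes "weighted_norm \<delta> b < r" "weighted_norm \<delta> b' < r"
  shows "\<bar>potential L \<delta> a b - potential L \<delta> a b'\<bar> \<le> \<rho> * weighted_norm \<delta> (b - b')"
proof -
  define u v where "u = weighted_norm \<delta> (L a - b)" and "v = weighted_norm \<delta> (L a - b')"
  have uv: "0 \<le> u" "u \<le> \<rho>" "0 \<le> v" "v \<le> \<rho>"
    using weighted_misfit_le assms by (auto simp: u_def v_def weighted_norm_def)
  have "\<bar>norm (L a - b) - norm (L a - b')\<bar> \<le> norm (b - b')"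
    using norm_triangle_ineq3[of "L a - b" "L a - b'"] by (simp add: norm_minus_commute)
  then have "\<bar>u - v\<bar> \<le> weighted_norm \<delta> (b - b')"
    using \<delta> by (simp add: u_def v_def weighted_norm_eq divide_right_mono flip: diff_divide_distrib)
  then have "\<bar>u - v\<bar> * ((u + v) / 2) \<le> weighted_norm \<delta> (b - b') * \<rho>"
    using uv by (intro mult_mono) (auto simp: weighted_norm_def)
  moreover have "\<bar>potential L \<delta> a b - potential L \<delta> a b'\<bar> = \<bar>u\<^sup>2 - v\<^sup>2\<bar> / 2"
    using \<delta> by (simp add: potential_eq_weighted_norm u_def v_def flip: diff_divide_distrib)
  moreover have "\<bar>u\<^sup>2 - v\<^sup>2\<bar> = \<bar>u - v\<bar> * (u + v)"
    using uv by (simp add: power2_eq_square square_diff_square_factored abs_mult)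
  ultimately show ?thesis
    by (simp add: mult.commute)
qed

lemma measurable_potential [measurable]: "(\<lambda>a. potential L \<delta> a b) \<in> borel_measurable borel"
  unfolding potential_def by measurable

lemma integrable_likelihood: "integrable gaussian_prior (\<lambda>a. exp (- potential L \<delta> a b))"
  by (rule prior.integrable_const_bound[where B = 1]) (auto simp: potential_nonneg)

lemma evidence_ge:
  assumes "weighted_norm \<delta> b < r"
  shows "exp (- (\<rho>\<^sup>2 / 2)) \<le> evidence L \<delta> b"
proof -
  \<comment> \<open>The likelihood is at least \<open>exp (- \<rho>\<^sup>2 / 2)\<close> pointwise, and the prior has mass 1.\<close>
  have "(LINT a|(gaussian_prior :: (real ^ 'j) measure). exp (- (\<rho>\<^sup>2 / 2))) \<le> evidence L \<delta> b"
    unfolding evidence_def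
    using potential_le[OF assms] by (intro integral_mono integrable_likelihood) auto
  then show ?thesis
    using prior.prob_space by simp
qed

lemma evidence_pos:
  assumes "weighted_norm \<delta> b < r"
  shows "0 < evidence L \<delta> b"
  using evidence_ge[OF assms] by (rule less_le_trans[OF exp_gt_zero])

lemma ln_evidence_ge:
  assumes "weighted_norm \<delta> b < r"
  shows "- (\<rho>\<^sup>2 / 2) \<le> ln (evidence L \<delta> b)"
  using evidence_ge[OF assms] evidence_pos[OF assms] by (simp add: ln_ge_iff)

text \<open>
  If the potential changes by at most \<open>q\<close> for every coefficient vector, then the likelihood, and
  hence its integral, changes at most by a factor \<open>exp q\<close>. On the logarithmic scale the evidence
  thus inherits the Lipschitz constant of the potential.
\<close>

lemma ln_evidence_lipschitz:
  assumes "weighted_norm \<delta> b < r" "weighted_norm \<delta> b' < r"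
  shows "\<bar>ln (evidence L \<delta> b) - ln (evidence L \<delta> b')\<bar> \<le> \<rho> * weighted_norm \<delta> (b - b')"
proof -
  have *: "ln (evidence L \<delta> b) - \<rho> * weighted_norm \<delta> (b - b') \<le> ln (evidence L \<delta> b')"
    if b: "weighted_norm \<delta> b < r" and b': "weighted_norm \<delta> b' < r" for b b'
  proof -
    let ?q = "\<rho> * weighted_norm \<delta> (b - b')"
    have "exp (- ?q) * exp (- potential L \<delta> a b) \<le> exp (- potential L \<delta> a b')" for a
      using potential_lipschitz[OF b b', of a] by (simp add: flip: exp_add)
    then have "(LINT a|gaussian_prior. exp (- ?q) * exp (- potential L \<delta> a b)) \<le> evidence L \<delta> b'"
      unfolding evidence_def
      by (intro integral_mono integrable_likelihood integrable_mult_right) auto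
    then have "exp (- ?q) * evidence L \<delta> b \<le> evidence L \<delta> b'"
      by (simp add: evidence_def)
    also have "exp (- ?q) * evidence L \<delta> b = exp (ln (evidence L \<delta> b) - ?q)"
      using evidence_pos[OF b] by (simp add: exp_diff exp_minus divide_inverse)
    finally show ?thesis
      using evidence_pos[OF b'] by (simp add: ln_ge_iff)
  qed
  show ?thesis
    using *[OF assms] *[OF assms(2,1)]
    by (simp add: abs_le_iff weighted_norm_def norm_minus_commute)
qed

text \<open>
  Writing the normalised density as a single exponential lets the factor \<open>1 / Z\<close> and the
  likelihood be estimated together.
\<close>

lemma sqrt_posterior_density:
  assumes "weighted_norm \<delta> b < r"
  shows "AE a in gaussian_prior. sqrt (enn2real (RN_deriv gaussian_prior (posterior L \<delta> b) a))
           = exp (- ((potential L \<delta> a b + ln (evidence L \<delta> b)) / 2))"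
proof -
  have "AE a in gaussian_prior. ennreal (1 / evidence L \<delta> b * exp (- potential L \<delta> a b))
          = RN_deriv gaussian_prior (posterior L \<delta> b) a"
    by (rule prior.RN_deriv_unique) (auto simp: posterior_def)
  then show ?thesis
  proof eventually_elim
    case (elim a)
    let ?p = "potential L \<delta> a b" and ?Z = "evidence L \<delta> b"
    have Z: "0 < ?Z" by (rule evidence_pos[OF assms])
    then have "enn2real (RN_deriv gaussian_prior (posterior L \<delta> b) a) = 1 / ?Z * exp (- ?p)"
      by (simp flip: elim)
    also have "\<dots> = exp (- (?p + ln ?Z))"
      using Z by (simp add: exp_diff exp_minus field_simps)
    also have "\<dots> = (exp (- ((?p + ln ?Z) / 2)))\<^sup>2"
      by (simp add: field_simps flip: exp_double)
    finally show ?case by simp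
  qed
qed

text \<open>
  The bound on the roots of the densities is uniform in the coefficient vector, so that integrating
  its square over a probability measure loses nothing.
\<close>

lemma hellinger_dist_posterior_le:
  assumes b: "weighted_norm \<delta> b < r" and b': "weighted_norm \<delta> b' < r"
  shows "hellinger_dist gaussian_prior (posterior L \<delta> b) (posterior L \<delta> b')
           \<le> \<rho> * exp (\<rho>\<^sup>2 / 4) * weighted_norm \<delta> (b - b')"
proof -
  define B where "B = \<rho> * exp (\<rho>\<^sup>2 / 4) * weighted_norm \<delta> (b - b')"
  define \<phi> where "\<phi> = (\<lambda>b a. (potential L \<delta> a b + ln (evidence L \<delta> b)) / 2)"
  have "\<rho> \<ge> 0"
    using weighted_misfit_le[OF b, of undefined] by (rule order_trans[rotated]) (simp add: weighted_norm_def)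
  then have B: "B \<ge> 0"
    by (simp add: B_def weighted_norm_def)
  have pointwise: "\<bar>exp (- \<phi> b a) - exp (- \<phi> b' a)\<bar> \<le> B" for a
  proof -
    have "\<bar>exp (- \<phi> b a) - exp (- \<phi> b' a)\<bar> \<le> exp (\<rho>\<^sup>2 / 4) * \<bar>- \<phi> b a - (- \<phi> b' a)\<bar>"
    proof (rule abs_exp_diff_le)
      show "- \<phi> b a \<le> \<rho>\<^sup>2 / 4"
        using potential_nonneg[of a b] ln_evidence_ge[OF b] by (simp add: \<phi>_def field_simps)
      show "- \<phi> b' a \<le> \<rho>\<^sup>2 / 4"
        using potential_nonneg[of a b'] ln_evidence_ge[OF b'] by (simp add: \<phi>_def field_simps)
    qed
    also have "\<bar>- \<phi> b a - (- \<phi> b' a)\<bar> \<le> \<rho> * weighted_norm \<delta> (b - b')"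
      using potential_lipschitz[OF b b', of a] ln_evidence_lipschitz[OF b b']
      unfolding \<phi>_def abs_le_iff by (auto simp: field_simps)
    finally show ?thesis
      by (simp add: B_def mult_ac)
  qed
  have "(LINT a|gaussian_prior. (sqrt (enn2real (RN_deriv gaussian_prior (posterior L \<delta> b) a))
            - sqrt (enn2real (RN_deriv gaussian_prior (posterior L \<delta> b') a)))\<^sup>2)
        \<le> (LINT a|(gaussian_prior :: (real ^ 'j) measure). B\<^sup>2)"
  proof (rule integral_mono_AE')
    show "AE a in gaussian_prior. (sqrt (enn2real (RN_deriv gaussian_prior (posterior L \<delta> b) a))
            - sqrt (enn2real (RN_deriv gaussian_prior (posterior L \<delta> b') a)))\<^sup>2 \<le> B\<^sup>2"
      using sqrt_posterior_density[OF b] sqrt_posterior_density[OF b']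
    proof eventually_elim
      case (elim a)
      show ?case
        unfolding elim using pointwise[of a] B by (simp add: \<phi>_def abs_le_square_iff[symmetric])
    qed
  qed auto
  also have "\<dots> = B\<^sup>2"
    using prior.prob_space by simp
  finally have "hellinger_dist gaussian_prior (posterior L \<delta> b) (posterior L \<delta> b') \<le> sqrt (1 / 2 * B\<^sup>2)"
    unfolding hellinger_dist_def by (intro real_sqrt_le_mono mult_left_mono) auto
  also have "\<dots> \<le> sqrt (B\<^sup>2)"
    by (intro real_sqrt_le_mono) auto
  also have "\<dots> = B"
    using B by simp
  finally show ?thesis
    by (simp add: B_def)
qed

end

section \<open>The Hankel function away from its singularity\<close>

text \<open>
  This puts the harmonic numbers, the coefficients in the series for \<open>Y\<^sub>0\<close>, within reach of
  the comparison with the exponential series below.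
\<close>

lemma harm_le_fact: "harm n \<le> (fact n :: real)"
proof (induction n)
  case (Suc n)
  show ?case
  proof (cases n)
    case 0
    then show ?thesis by (simp add: harm_expand)
  next
    case (Suc m)
    then have "1 \<le> real n" by simp
    then have "1 * 1 \<le> real n * fact n"
      by (intro mult_mono fact_ge_1) auto
    then have n: "1 \<le> real n * fact n" by simp
    have "inverse (real (Suc n)) \<le> 1" by (simp add: field_simps)
    also note n
    finally show ?thesis
      using Suc.IH by (simp add: harm_Suc algebra_simps)
  qed
qed (simp add: harm_expand)

text \<open>
  One of the two factorials in the denominator absorbs the coefficient, and what is left is
  dominated by the exponential series. The lemma serves both \<open>J\<^sub>0\<close> and the series part of
  \<open>Y\<^sub>0\<close>.
\<close>

lemma abs_suminf_le_exp:
  fixes c :: "nat \<Rightarrow> real"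
  assumes "\<And>i. \<bar>c i\<bar> \<le> fact i" and "t \<ge> 0"
  shows "\<bar>\<Sum>i. (- 1) ^ i * c i * t ^ i / (fact i)\<^sup>2\<bar> \<le> exp t"
proof -
  have "norm (\<Sum>i. (- 1) ^ i * c i * t ^ i / (fact i)\<^sup>2) \<le> (\<Sum>i. t ^ i /\<^sub>R fact i)"
  proof (rule norm_suminf_le)
    fix i
    have "\<bar>c i\<bar> * t ^ i / (fact i)\<^sup>2 \<le> fact i * t ^ i / (fact i)\<^sup>2"
      using assms by (intro divide_right_mono mult_right_mono) auto
    also have "\<dots> = t ^ i /\<^sub>R fact i"
      by (simp add: power2_eq_square field_simps)
    finally show "norm ((- 1) ^ i * c i * t ^ i / (fact i)\<^sup>2) \<le> t ^ i /\<^sub>R fact i"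
      using \<open>t \<ge> 0\<close> by (simp add: abs_mult power_abs)
  qed (rule summable_exp_generic)
  then show ?thesis by (simp add: exp_def)
qed

lemma abs_bessel_J0_le: "\<bar>bessel_J0 z\<bar> \<le> exp (z\<^sup>2 / 4)"
  using abs_suminf_le_exp[of "\<lambda>_. 1" "z\<^sup>2 / 4"] by (simp add: bessel_J0_def fact_ge_1)

lemma abs_bessel_Y0_le:
  "\<bar>bessel_Y0 z\<bar> \<le> 2 / pi * ((\<bar>ln (z / 2) + euler_mascheroni\<bar> + 1) * exp (z\<^sup>2 / 4))"
proof -
  let ?S = "\<Sum>i. (- 1) ^ i * harm i * (z\<^sup>2 / 4) ^ i / (fact i)\<^sup>2 :: real"
  have "\<bar>(ln (z / 2) + euler_mascheroni) * bessel_J0 z\<bar>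
          \<le> \<bar>ln (z / 2) + euler_mascheroni\<bar> * exp (z\<^sup>2 / 4)"
    by (simp add: abs_mult abs_bessel_J0_le mult_left_mono)
  moreover have "\<bar>?S\<bar> \<le> exp (z\<^sup>2 / 4)"
    by (rule abs_suminf_le_exp) (auto simp: harm_le_fact)
  ultimately have "\<bar>(ln (z / 2) + euler_mascheroni) * bessel_J0 z - ?S\<bar>
          \<le> (\<bar>ln (z / 2) + euler_mascheroni\<bar> + 1) * exp (z\<^sup>2 / 4)"
    by (simp add: algebra_simps)
  then show ?thesis
    unfolding bessel_Y0_def by (simp add: abs_mult divide_right_mono)
qed

lemma hankel1_0_bounded:
  assumes "0 < p"
  shows "\<exists>B. \<forall>z\<in>{p..q}. norm (hankel1_0 z) \<le> B"
proof -
  have "norm (hankel1_0 z) \<le> exp (q\<^sup>2 / 4) + 2 / pi * ((\<bar>ln (p / 2)\<bar> + \<bar>ln (q / 2)\<bar> + euler_mascheroni + 1) * exp (q\<^sup>2 / 4))"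
    if z: "z \<in> {p..q}" for z
  proof -
    have e: "exp (z\<^sup>2 / 4) \<le> exp (q\<^sup>2 / 4)"
      using z assms by (simp add: power_mono)
    have "ln (p / 2) \<le> ln (z / 2)" "ln (z / 2) \<le> ln (q / 2)"
      using z assms by simp_all
    then have l: "\<bar>ln (z / 2) + euler_mascheroni\<bar> \<le> \<bar>ln (p / 2)\<bar> + \<bar>ln (q / 2)\<bar> + euler_mascheroni"
      using euler_mascheroni_pos by linarith
    have "norm (hankel1_0 z) \<le> \<bar>bessel_J0 z\<bar> + \<bar>bessel_Y0 z\<bar>"
      unfolding hankel1_0_def by (rule order_trans[OF norm_triangle_ineq]) (simp add: norm_mult)
    also have "\<bar>bessel_J0 z\<bar> \<le> exp (q\<^sup>2 / 4)"
      using abs_bessel_J0_le e by (rule order_trans)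
    also have "\<bar>bessel_Y0 z\<bar> \<le> 2 / pi * ((\<bar>ln (p / 2)\<bar> + \<bar>ln (q / 2)\<bar> + euler_mascheroni + 1) * exp (q\<^sup>2 / 4))"
      by (rule order_trans[OF abs_bessel_Y0_le]) (intro mult_left_mono mult_mono e add_right_mono l,
         auto intro!: add_nonneg_nonneg less_imp_le[OF euler_mascheroni_pos])
    finally show ?thesis by simp
  qed
  then show ?thesis by blast
qed

lemma measurable_hankel1_0 [measurable]: "hankel1_0 \<in> borel_measurable borel"
  unfolding hankel1_0_def bessel_J0_def bessel_Y0_def by measurable

section \<open>The forward map is bounded and measurable\<close>

lemma level_set_map_bounded:
  assumes "\<And>l. l \<in> {1..n} \<Longrightarrow> w l \<ge> 0"
  shows "\<bar>level_set_map D n w c \<phi> y\<bar> \<le> (\<Sum>l = 1..n. w l)"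
proof -
  have "\<bar>level_set_map D n w c \<phi> y\<bar>
      \<le> (\<Sum>l = 1..n. \<bar>w l * indicator (level_region D c \<phi> l) y\<bar>)"
    unfolding level_set_map_def by (rule sum_abs)
  also have "\<dots> \<le> (\<Sum>l = 1..n. w l)"
    using assms by (intro sum_mono) (auto simp: indicator_def)
  finally show ?thesis .
qed

lemma measurable_rbf_expansion:
  "(\<lambda>(a, y). rbf_expansion \<theta> lam a y) \<in> borel_measurable (borel \<Otimes>\<^sub>M borel)"
  unfolding rbf_expansion_def by measurable

text \<open>
  Measurability is needed jointly in the coefficients and the point of the plane: this is what makes
  an integral over the plane a measurable function of the coefficients.
\<close>

lemma measurable_level_set_map_rbf:
  assumes [measurable]: "D \<in> sets borel"
  shows "(\<lambda>(a, y). level_set_map D n w c (rbf_expansion \<theta> lam a) y)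
           \<in> borel_measurable (borel \<Otimes>\<^sub>M borel)"
proof -
  have [measurable]: "(\<lambda>p. rbf_expansion \<theta> lam (fst p) (snd p)) \<in> borel_measurable (borel \<Otimes>\<^sub>M borel)"
    using measurable_rbf_expansion[of \<theta> lam] by (simp add: case_prod_beta')
  have "(\<lambda>p. indicator (level_region D c (rbf_expansion \<theta> lam (fst p)) l) (snd p) :: real)
      = indicator {p. snd p \<in> D \<and> c (l - 1) \<le> ereal (rbf_expansion \<theta> lam (fst p) (snd p))
                   \<and> ereal (rbf_expansion \<theta> lam (fst p) (snd p)) < c l}" for l
    by (auto simp: level_region_def indicator_def)
  moreover have "Measurable.pred (borel \<Otimes>\<^sub>M borel)
      (\<lambda>p. snd p \<in> D \<and> c (l - 1) \<le> ereal (rbf_expansion \<theta> lam (fst p) (snd p))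
                   \<and> ereal (rbf_expansion \<theta> lam (fst p) (snd p)) < c l)" for l
    by measurable
  ultimately have [measurable]: "(\<lambda>p. indicator (level_region D c (rbf_expansion \<theta> lam (fst p)) l) (snd p) :: real)
      \<in> borel_measurable (borel \<Otimes>\<^sub>M borel)" for l
    by (simp add: pred_def space_pair_measure)
  show ?thesis
    unfolding level_set_map_def case_prod_beta' by measurable
qed

lemma borel_measurable_vecI:
  fixes f :: "'a \<Rightarrow> 'b :: euclidean_space ^ 'n :: finite"
  assumes "\<And>i. (\<lambda>x. f x $ i) \<in> borel_measurable M"
  shows "f \<in> borel_measurable M"
  unfolding borel_measurable_euclidean_space[of f]
  using assms by (auto simp: Basis_vec_def inner_axis)

lemma norm_vec_le_card:
  fixes v :: "'b :: real_normed_vector ^ 'n :: finite"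
  assumes "\<And>i. norm (v $ i) \<le> B"
  shows "norm v \<le> real CARD('n) * B"
proof -
  have "norm v \<le> (\<Sum>i\<in>UNIV. norm (v $ i))"
    unfolding norm_vec_def by (rule L2_set_le_sum) simp
  also have "\<dots> \<le> real CARD('n) * B"
    using sum_bounded_above[of UNIV "\<lambda>i. norm (v $ i)" B] assms by simp
  finally show ?thesis .
qed

lemma forward_map_nth:
  "forward_map D x k n w c \<theta> lam a $ p =
     (LINT y|lborel. indicator D y *\<^sub>R (complex_of_real (level_set_map D n w c (rbf_expansion \<theta> lam a) y)
        * hankel1_0 (k (fst p) * norm (x (snd p) - y))))"
  by (simp add: forward_map_def acoustic_operator_def acoustic_single_def set_lebesgue_integral_def)

lemma measurable_forward_map:
  assumes [measurable]: "D \<in> sets borel"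
  shows "forward_map D x k n w c \<theta> lam \<in> borel_measurable borel"
proof (rule borel_measurable_vecI)
  fix p
  have [measurable]: "(\<lambda>p. level_set_map D n w c (rbf_expansion \<theta> lam (fst p)) (snd p))
           \<in> borel_measurable (borel \<Otimes>\<^sub>M lborel)"
    using measurable_level_set_map_rbf[OF assms, of n w c \<theta> lam] by (simp add: case_prod_beta' cong: measurable_cong_sets)
  show "(\<lambda>a. forward_map D x k n w c \<theta> lam a $ p) \<in> borel_measurable borel"
    unfolding forward_map_nth
    by (rule sigma_finite_measure.borel_measurable_lebesgue_integral[OF lborel.sigma_finite_measure_axioms])
       (simp add: case_prod_beta')
qed

lemma norm_forward_map_le:
  fixes x :: "'n :: finite \<Rightarrow> real ^ 2" and k :: "'m :: finite \<Rightarrow> real"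
  assumes D: "D \<in> sets borel" "bounded D"
    and w: "\<And>l. l \<in> {1..n} \<Longrightarrow> w l \<ge> 0"
    and B: "\<And>m j y. y \<in> D \<Longrightarrow> norm (hankel1_0 (k m * norm (x j - y))) \<le> B"
  shows "norm (forward_map D x k n w c \<theta> lam a)
           \<le> real CARD('m \<times> 'n) * ((\<Sum>l = 1..n. w l) * B * measure lborel D)"
proof (rule norm_vec_le_card)
  fix p :: "'m \<times> 'n"
  define W where "W = (\<Sum>l = 1..n. w l)"
  let ?g = "\<lambda>y. indicator D y *\<^sub>R (complex_of_real (level_set_map D n w c (rbf_expansion \<theta> lam a) y)
        * hankel1_0 (k (fst p) * norm (x (snd p) - y)))"
  have bound: "norm (?g y) \<le> indicator D y * (W * B)" for y
  proof (cases "y \<in> D")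
    case True
    have "\<bar>level_set_map D n w c (rbf_expansion \<theta> lam a) y\<bar>
            * norm (hankel1_0 (k (fst p) * norm (x (snd p) - y))) \<le> W * B"
      unfolding W_def
      using w by (intro mult_mono level_set_map_bounded B True sum_nonneg) auto
    then show ?thesis
      using True by (simp add: norm_mult)
  qed simp
  have "integrable lborel (\<lambda>y. indicator D y * (W * B))"
    using D emeasure_bounded_finite[of D]
    by (intro integrable_mult_left integrable_real_indicator) auto
  then have "norm (LINT y|lborel. ?g y) \<le> (LINT y|lborel. indicator D y * (W * B))"
    by (intro order_trans[OF integral_norm_bound] integral_mono' bound) (auto intro: order_trans[OF norm_ge_zero bound])
  also have "\<dots> = W * B * measure lborel D"
    using D by simp
  finally show "norm (forward_map D x k n w c \<theta> lam a $ p) \<le> (\<Sum>l = 1..n. w l) * B * measure lborel D"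
    unfolding forward_map_nth W_def .
qed

text \<open>
  An open set is disjoint from its frontier. Hence the finite set of observation points and the
  compact set \<open>closure D\<close> are disjoint, at positive distance \<open>d\<close>, and by boundedness their points
  are at most some \<open>e\<close> apart.
\<close>

lemma hankel_kernel_bounded:
  fixes x :: "'n :: finite \<Rightarrow> real ^ 2" and k :: "'m \<Rightarrow> real"
  assumes \<Omega>: "open \<Omega>" and D: "compactly_contained D \<Omega>"
    and x: "\<And>j. x j \<in> frontier \<Omega>"
    and k: "k_min > 0" "\<And>m. k m \<in> {k_min..k_max}"
  shows "\<exists>B. \<forall>m j. \<forall>y\<in>D. norm (hankel1_0 (k m * norm (x j - y))) \<le> B"
proof -
  have K: "compact (closure D)" "closure D \<subseteq> \<Omega>"
    using D by (auto simp: compactly_contained_def)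
  have "range x \<inter> closure D = {}"
    using x K(2) frontier_disjoint_eq[of \<Omega>] \<Omega> by blast
  then obtain d where d: "d > 0" "\<And>p y. p \<in> range x \<Longrightarrow> y \<in> closure D \<Longrightarrow> d \<le> dist p y"
    using separate_compact_closed[of "range x" "closure D"] finite_imp_compact[of "range x"]
    by (metis closed_closure finite_class.finite_UNIV finite_imageI)
  have "bounded (range x \<union> closure D)"
    using K(1) by (auto intro: finite_imp_bounded compact_imp_bounded)
  then obtain e where e: "\<And>p y. p \<in> range x \<union> closure D \<Longrightarrow> y \<in> range x \<union> closure D \<Longrightarrow> dist p y \<le> e"
    by (auto simp: bounded_two_points)
  obtain B where B: "\<And>z. z \<in> {k_min * d..k_max * e} \<Longrightarrow> norm (hankel1_0 z) \<le> B"
    using hankel1_0_bounded[OF mult_pos_pos[OF k(1) d(1)], of "k_max * e"] by blast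
  have "k m * norm (x j - y) \<in> {k_min * d..k_max * e}" if "y \<in> D" for m j y
  proof -
    have y: "y \<in> closure D" using that closure_subset by blast
    have "d \<le> norm (x j - y)" "norm (x j - y) \<le> e"
      using d(2)[of "x j" y] e[of "x j" y] y by (auto simp: dist_norm)
    then show ?thesis
      using k(1) k(2)[of m] d(1) by (auto intro!: mult_mono)
  qed
  then show ?thesis
    using B by blast
qed

section \<open>Local Lipschitz continuity of the acoustic posterior\<close>

theorem theorem4p4:
  fixes \<Omega> D :: "(real ^ 2) set"
    and x :: "'n :: finite \<Rightarrow> real ^ 2"
    and k :: "'m :: finite \<Rightarrow> real" and k_min k_max :: real
    and n :: nat and w :: "nat \<Rightarrow> real" and c :: "nat \<Rightarrow> ereal"
    and \<theta> :: "'j :: finite \<Rightarrow> real ^ 2" and lam :: "'j \<Rightarrow> real"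
    and \<delta> :: real
    and L :: "real ^ 'j \<Rightarrow> complex ^ ('m \<times> 'n)"
  assumes "region_bounded_by_closed_curve \<Omega>"
    and "open D" and "bounded D" and "compactly_contained D \<Omega>"
    and "\<And>j. x j \<in> frontier \<Omega>"
    and "k_min > 0" and "\<And>m. k m \<in> {k_min..k_max}"
    and "n \<ge> 1"
    and "\<And>l. l \<in> {1..n} \<Longrightarrow> w l > 0"
    and "c 0 = - \<infinity>" and "c n = \<infinity>" and "\<And>l. l < n \<Longrightarrow> c l < c (Suc l)"
    and "\<And>s. lam s > 0"
    and "\<delta> > 0"
  defines "L \<equiv> forward_map D x k n w c \<theta> lam"
  shows "\<forall>r>0. \<exists>C>0. \<forall>b b'. max (weighted_norm \<delta> b) (weighted_norm \<delta> b') < r \<longrightarrow>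
           hellinger_dist gaussian_prior (posterior L \<delta> b) (posterior L \<delta> b')
             \<le> C * weighted_norm \<delta> (b - b')"
proof (intro allI impI)
  fix r :: real
  assume r: "r > 0"
  have D: "D \<in> sets borel" using \<open>open D\<close> by simp
  have "open \<Omega>"
    using \<open>region_bounded_by_closed_curve \<Omega>\<close> by (simp add: region_bounded_by_closed_curve_def)
  then obtain B where B: "\<And>m j y. y \<in> D \<Longrightarrow> norm (hankel1_0 (k m * norm (x j - y))) \<le> B"
    using hankel_kernel_bounded[of \<Omega> D x k_min k k_max] assms(4-7) by metis
  define R where "R = real CARD('m \<times> 'n) * ((\<Sum>l = 1..n. w l) * B * measure lborel D)"
  have meas: "L \<in> borel_measurable borel"
    unfolding L_def by (rule measurable_forward_map[OF D])
  have bound: "norm (L a) \<le> R" for a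
    unfolding L_def R_def using assms(9)
    by (intro norm_forward_map_le D \<open>bounded D\<close> B) (auto intro: less_imp_le)
  define \<rho> where "\<rho> = R / \<delta> + r"
  have "R \<ge> 0"
    using bound[of undefined] by (rule order_trans[OF norm_ge_zero])
  then have "\<rho> > 0"
    using r \<open>\<delta> > 0\<close> by (simp add: \<rho>_def add_nonneg_pos)
  then have "\<rho> * exp (\<rho>\<^sup>2 / 4) > 0"
    by simp
  moreover have "hellinger_dist gaussian_prior (posterior L \<delta> b) (posterior L \<delta> b')
             \<le> \<rho> * exp (\<rho>\<^sup>2 / 4) * weighted_norm \<delta> (b - b')"
    if "max (weighted_norm \<delta> b) (weighted_norm \<delta> b') < r" for b b'
    unfolding \<rho>_def using that
    by (intro hellinger_dist_posterior_le meas bound \<open>\<delta> > 0\<close>) auto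
  ultimately show "\<exists>C>0. \<forall>b b'. max (weighted_norm \<delta> b) (weighted_norm \<delta> b') < r \<longrightarrow>
           hellinger_dist gaussian_prior (posterior L \<delta> b) (posterior L \<delta> b')
             \<le> C * weighted_norm \<delta> (b - b')"
    by blast
qed

end
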